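(* Let $f\in\mathbb{B}_n$. Then the procedure ANFto2XNF (described in the context), applied to $f$, terminates after finitely many steps and returns a 2-XNF representation of $f$.
   Context: $\mathbb{B}_n=\mathbb{F}_2[X_1,\dots,X_n]/\langle X_1^2-X_1,\dots,X_n^2-X_n\rangle$ is the ring of Boolean polynomials, with indeterminates $x_i$ the residue classes of $X_i$. $\mathbb{B}_{n,m}$ is the Boolean polynomial ring in $n+m$ indeterminates $x_1,\dots,x_n,y_1,\dots,y_m$. Every Boolean polynomial is uniquely a sum of distinct square-free terms (products of distinct indeterminates); the set of these terms is its support $\mathrm{Supp}(f)$, and the degree is the maximal degree of a term in the support. A Boolean polynomial is called linear if it lies in the $\mathbb{F}_2$-span of $1$ and the indeterminates. For a subset $S$ of a Boolean polynomial ring in $N$ indeterminates, $\mathcal{Z}(S)\subseteq\mathbb{F}_2^N$ is the set of common zeros of the elements of $S$. For $S\subseteq\mathbb{F}_2^n$ and $T\subseteq\mathbb{F}_2^{n+m}$ write $S\equiv_n T$ if the projection to the first $n$ coordinates restricts to a bijection $T\to S$. A set $S=\{f_1g_1,\dots,f_kg_k,\ell_1,\dots,\ell_s\}\subseteq\mathbb{B}_{n,m}$ (for some $m\ge 0$), with all $f_i,g_i,\ell_j$ linear Boolean polynomials of $\mathbb{B}_{n,m}$, is called a 2-XNF representation of an ideal $I\subseteq\mathbb{B}_n$ if $\mathcal{Z}(I)\equiv_n\mathcal{Z}(S)$. A 2-XNF representation of $f\in\mathbb{B}_n$ is a 2-XNF representation of $\langle f\rangle$. Procedure ANFto2XNF.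 Input $f\in\mathbb{B}_n$. Start with $i=0$, $M=\emptyset$. For each term $t$ in the support of the input polynomial: while $\deg(t)>1$, increase $i$ by $1$ and let $y_i$ be a new indeterminate; write $f=t+f'$ (with $f'=f-t\in\mathbb{B}_{n,i-1}$) and $t=\ell_1\ell_2 s$ where $s$ is a term and $\ell_1,\ell_2$ are distinct indeterminates (dividing $t$, with $s$ the product of the remaining indeterminates of $t$); replace $t$ by $y_is$ and $f$ by $y_is+f'$; adjoin $y_i(\ell_2+1)$ and $\ell_2(\ell_1+y_i)$ to $M$. Finally return $M\cup\{f\}$. *)

theory Defs
  imports Main "HOL-Library.Z2" "HOL-Library.Poly_Mapping"
begin

section \<open>Ideals of a subring\<close>

definition ideal_in :: "'a::comm_ring_1 set \<Rightarrow> 'a set \<Rightarrow> bool" where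
  "ideal_in R I \<longleftrightarrow> I \<subseteq> R \<and> 0 \<in> I \<and> (\<forall>a\<in>I. \<forall>b\<in>I. a + b \<in> I) \<and> (\<forall>r\<in>R. \<forall>a\<in>I. r * a \<in> I)"

definition ideal_gen :: "'a::comm_ring_1 set \<Rightarrow> 'a set \<Rightarrow> 'a set" where
  "ideal_gen R S = \<Inter>{I. ideal_in R I \<and> S \<subseteq> I}"

definition subring_in :: "'a::comm_ring_1 set \<Rightarrow> bool" where
  "subring_in R \<longleftrightarrow> 1 \<in> R \<and> (\<forall>a\<in>R. \<forall>b\<in>R. a - b \<in> R \<and> a * b \<in> R)"

lemma subring_inD:
  assumes "subring_in R"
  shows "1 \<in> R" "0 \<in> R" "a \<in> R \<Longrightarrow> - a \<in> R" "a \<in> R \<Longrightarrow> b \<in> R \<Longrightarrow> a - b \<in> R"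
    "a \<in> R \<Longrightarrow> b \<in> R \<Longrightarrow> a + b \<in> R" "a \<in> R \<Longrightarrow> b \<in> R \<Longrightarrow> a * b \<in> R"
    "a \<in> R \<Longrightarrow> a ^ k \<in> R"
proof -
  show 1: "1 \<in> R" and d: "\<And>a b. a \<in> R \<Longrightarrow> b \<in> R \<Longrightarrow> a - b \<in> R"
    and m: "\<And>a b. a \<in> R \<Longrightarrow> b \<in> R \<Longrightarrow> a * b \<in> R"
    using assms by (auto simp: subring_in_def)
  show z: "0 \<in> R" using d[OF 1 1] by simp
  show n: "\<And>a. a \<in> R \<Longrightarrow> - a \<in> R" using d[OF z] by simp
  show "a \<in> R \<Longrightarrow> b \<in> R \<Longrightarrow> a + b \<in> R" using d[OF _ n, of a b] by simp
  show "a \<in> R \<Longrightarrow> a ^ k \<in> R" by (induction k) (auto intro: 1 m)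
qed

lemma subring_in_UNIV: "subring_in UNIV"
  by (simp add: subring_in_def)

lemma subring_in_prod:
  assumes "subring_in R" "\<And>i. i \<in> A \<Longrightarrow> f i \<in> R"
  shows "prod f A \<in> R"
  using assms(2) by (induction A rule: infinite_finite_induct) (auto intro: subring_inD[OF assms(1)])

lemma subring_in_sum:
  assumes "subring_in R" "\<And>i. i \<in> A \<Longrightarrow> f i \<in> R"
  shows "sum f A \<in> R"
  using assms(2) by (induction A rule: infinite_finite_induct) (auto intro: subring_inD[OF assms(1)])

lemma ideal_in_ideal_gen:
  assumes "subring_in R" "S \<subseteq> R"
  shows "ideal_in R (ideal_gen R S)"
proof -
  have "ideal_in R R"
    using assms(1) by (auto simp: ideal_in_def intro: subring_inD)
  with assms(2) show ?thesis
    by (auto simp: ideal_in_def ideal_gen_def)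
qed

lemma ideal_gen_superset: "S \<subseteq> ideal_gen R S"
  by (auto simp: ideal_gen_def)

lemma ideal_gen_minimal: "ideal_in R I \<Longrightarrow> S \<subseteq> I \<Longrightarrow> ideal_gen R S \<subseteq> I"
  by (auto simp: ideal_gen_def)

locale subring_ideal =
  fixes R I :: "'a::comm_ring_1 set"
  assumes R: "subring_in R" and I: "ideal_in R I"
begin

lemma in_R: "a \<in> I \<Longrightarrow> a \<in> R" and zero: "0 \<in> I"
  and add: "a \<in> I \<Longrightarrow> b \<in> I \<Longrightarrow> a + b \<in> I" and mult: "r \<in> R \<Longrightarrow> a \<in> I \<Longrightarrow> r * a \<in> I"
  using I by (auto simp: ideal_in_def)

lemma neg: "a \<in> I \<Longrightarrow> - a \<in> I"
  using mult[of "- 1" a] subring_inD[OF R] by simp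

lemma diff: "a \<in> I \<Longrightarrow> b \<in> I \<Longrightarrow> a - b \<in> I"
  using add[of a "- b"] neg by simp

lemma swap: "a - b \<in> I \<Longrightarrow> b - a \<in> I"
  using neg[of "a - b"] by simp

lemma cong_trans: "a - b \<in> I \<Longrightarrow> b - c \<in> I \<Longrightarrow> a - c \<in> I"
  using add[of "a - b" "b - c"] by simp

lemma cong_add: "a - b \<in> I \<Longrightarrow> c - d \<in> I \<Longrightarrow> (a + c) - (b + d) \<in> I"
  using add[of "a - b" "c - d"] by (simp add: algebra_simps)

lemma cong_mult:
  assumes "a - b \<in> I" "c - d \<in> I" "b \<in> R" "c \<in> R"
  shows "a * c - b * d \<in> I"
proof -
  have "c * (a - b) + b * (c - d) \<in> I"
    using assms by (intro add mult)
  then show ?thesis by (simp add: algebra_simps)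
qed

lemma cong_sum: "(\<And>i. i \<in> A \<Longrightarrow> f i - g i \<in> I) \<Longrightarrow> sum f A - sum g A \<in> I"
  by (induction A rule: infinite_finite_induct) (auto intro: zero cong_add)

lemma cong_prod:
  assumes "\<And>i. i \<in> A \<Longrightarrow> f i - g i \<in> I" "\<And>i. i \<in> A \<Longrightarrow> f i \<in> R" "\<And>i. i \<in> A \<Longrightarrow> g i \<in> R"
  shows "prod f A - prod g A \<in> I"
  using assms
  by (induction A rule: infinite_finite_induct)
    (auto intro!: zero cong_mult subring_in_prod[OF R])

end

section \<open>Boolean polynomials\<close>

text \<open>
  All rings of Boolean polynomials in finitely many indeterminates live in one quotient, of
  the polynomial ring over the two-element field \<^typ>\<open>bit\<close> in the indeterminates \<open>X\<^sub>0, X\<^sub>1, \<dots>\<close>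
  by the ideal generated by all \<open>X\<^sub>i\<^sup>2 - X\<^sub>i\<close>.  A power product is its exponent function
  \<open>nat \<Rightarrow>\<^sub>0 nat\<close>.
\<close>

type_synonym mpoly2 = "(nat \<Rightarrow>\<^sub>0 nat) \<Rightarrow>\<^sub>0 bit"

definition Xvar :: "nat \<Rightarrow> mpoly2" where
  "Xvar i = Poly_Mapping.single (Poly_Mapping.single i 1) 1"

definition mpolys :: "nat \<Rightarrow> mpoly2 set" where
  "mpolys N = {P. \<forall>m \<in> Poly_Mapping.keys P. Poly_Mapping.keys m \<subseteq> {..<N}}"

definition bool_ideal :: "mpoly2 set" where
  "bool_ideal = ideal_gen UNIV {Xvar i ^ 2 - Xvar i | i. True}"

interpretation bool_ideal: subring_ideal UNIV bool_ideal
  by unfold_locales (auto simp: bool_ideal_def subring_in_UNIV intro!: ideal_in_ideal_gen)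

quotient_type bpoly = mpoly2 / "\<lambda>P Q. P - Q \<in> bool_ideal" morphisms rep_bpoly bclass
  by (auto intro!: equivpI reflpI sympI transpI bool_ideal.zero
      intro: bool_ideal.swap bool_ideal.cong_trans)

definition peval :: "(nat \<Rightarrow> bit) \<Rightarrow> mpoly2 \<Rightarrow> bit" where
  "peval v P = (\<Sum>m \<in> Poly_Mapping.keys P. Poly_Mapping.lookup P m *
     (\<Prod>i \<in> Poly_Mapping.keys m. v i ^ Poly_Mapping.lookup m i))"

lemma peval_mono_superset:
  assumes "finite A" "Poly_Mapping.keys m \<subseteq> A"
  shows "(\<Prod>i \<in> Poly_Mapping.keys m. v i ^ Poly_Mapping.lookup m i :: bit) =
    (\<Prod>i \<in> A. v i ^ Poly_Mapping.lookup m i)"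
  using assms by (intro prod.mono_neutral_left) (auto simp: in_keys_iff)

lemma peval_mono_add:
  "(\<Prod>i \<in> Poly_Mapping.keys (m + m'). v i ^ Poly_Mapping.lookup (m + m') i :: bit) =
    (\<Prod>i \<in> Poly_Mapping.keys m. v i ^ Poly_Mapping.lookup m i) *
    (\<Prod>i \<in> Poly_Mapping.keys m'. v i ^ Poly_Mapping.lookup m' i)"
proof -
  let ?A = "Poly_Mapping.keys m \<union> Poly_Mapping.keys m'"
  show ?thesis
    using keys_add[of m m']
    by (subst (1 2 3) peval_mono_superset[of ?A])
      (auto simp del: power_bit_unfold simp: lookup_add power_add prod.distrib)
qed

lemma peval_superset:
  assumes "finite A" "Poly_Mapping.keys P \<subseteq> A"
  shows "peval v P = (\<Sum>m \<in> A. Poly_Mapping.lookup P m *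
     (\<Prod>i \<in> Poly_Mapping.keys m. v i ^ Poly_Mapping.lookup m i))"
  unfolding peval_def
  using assms by (intro sum.mono_neutral_left) (auto simp: in_keys_iff simp del: bit_not_zero_iff)

lemma peval_add: "peval v (P + Q) = peval v P + peval v Q"
proof -
  let ?A = "Poly_Mapping.keys P \<union> Poly_Mapping.keys Q"
  show ?thesis
    using keys_add[of P Q]
    by (simp only: peval_superset[of ?A] finite_Un finite_keys Un_upper1 Un_upper2
        lookup_add distrib_right sum.distrib simp_thms)
qed

lemma peval_zero [simp]: "peval v 0 = 0"
  by (simp add: peval_def)

lemma peval_single:
  "peval v (Poly_Mapping.single m c) = c * (\<Prod>i \<in> Poly_Mapping.keys m. v i ^ Poly_Mapping.lookup m i)"
  by (cases "c = 0") (auto simp: peval_def simp del: power_bit_unfold)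

lemma peval_uminus: "peval v (- P) = peval v P"
  by (simp add: peval_def)

lemma peval_minus: "peval v (P - Q) = peval v P - peval v Q"
  using peval_add[of v P "- Q"] by (simp add: peval_uminus)

lemma peval_sum: "peval v (sum f A) = (\<Sum>i\<in>A. peval v (f i))"
  by (induction A rule: infinite_finite_induct) (auto simp: peval_add)

lemma mpoly_expand: "P = (\<Sum>m \<in> Poly_Mapping.keys P. Poly_Mapping.single m (Poly_Mapping.lookup P m))"
  by (rule poly_mapping_eqI)
    (auto simp: lookup_sum lookup_single when_def in_keys_iff simp del: bit_not_zero_iff)

lemma peval_mult: "peval v (P * Q) = peval v P * peval v Q"
proof -
  have "peval v (P * Q) =
    peval v (\<Sum>m\<in>Poly_Mapping.keys P. \<Sum>k\<in>Poly_Mapping.keys Q.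
      Poly_Mapping.single m (Poly_Mapping.lookup P m) * Poly_Mapping.single k (Poly_Mapping.lookup Q k))"
    by (subst mpoly_expand[of P], subst mpoly_expand[of Q]) (simp only: sum_product)
  also have "\<dots> = peval v P * peval v Q"
    unfolding peval_sum mult_single peval_single peval_mono_add
    by (simp only: peval_def sum_product mult_ac)
  finally show ?thesis .
qed

lemma peval_one [simp]: "peval v 1 = 1"
  using peval_single[of v 0 1] by simp

lemma peval_Xvar [simp]: "peval v (Xvar i) = v i"
  by (simp add: Xvar_def peval_single)

lemma peval_bool_ideal: "P \<in> bool_ideal \<Longrightarrow> peval v P = 0"
proof -
  have "bool_ideal \<subseteq> {P. peval v P = 0}"
    unfolding bool_ideal_def
    by (rule ideal_gen_minimal)
      (auto simp: ideal_in_def peval_add peval_mult peval_minus power2_eq_square)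
  then show "P \<in> bool_ideal \<Longrightarrow> peval v P = 0" by auto
qed

lift_definition beval :: "(nat \<Rightarrow> bit) \<Rightarrow> bpoly \<Rightarrow> bit" is peval
proof -
  fix v P Q assume "P - Q \<in> bool_ideal"
  then have "peval v P - peval v Q = 0"
    using peval_bool_ideal[of "P - Q" v] by (simp only: peval_minus)
  then show "peval v P = peval v Q"
    by (metis right_minus_eq)
qed

instantiation bpoly :: comm_ring_1
begin

lift_definition zero_bpoly :: bpoly is 0 .
lift_definition one_bpoly :: bpoly is 1 .
lift_definition plus_bpoly :: "bpoly \<Rightarrow> bpoly \<Rightarrow> bpoly" is "(+)"
  by (rule bool_ideal.cong_add)
lift_definition uminus_bpoly :: "bpoly \<Rightarrow> bpoly" is uminus
  by (simp add: bool_ideal.swap)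
lift_definition minus_bpoly :: "bpoly \<Rightarrow> bpoly \<Rightarrow> bpoly" is "(-)"
  subgoal for a b c d using bool_ideal.diff[of "a - b" "c - d"] by (simp add: algebra_simps)
  done
lift_definition times_bpoly :: "bpoly \<Rightarrow> bpoly \<Rightarrow> bpoly" is "(*)"
  by (rule bool_ideal.cong_mult) auto

instance
proof
  show "(0::bpoly) \<noteq> 1"
  proof transfer
    show "0 - 1 \<notin> bool_ideal"
    proof
      assume "0 - 1 \<in> bool_ideal"
      from peval_bool_ideal[OF this] show False
        unfolding peval_minus by simp
    qed
  qed
qed (transfer; simp add: algebra_simps bool_ideal.zero)+

end

lemma bclass_hom:
  "bclass 0 = 0" "bclass 1 = 1" "bclass (P + Q) = bclass P + bclass Q"
  "bclass (P - Q) = bclass P - bclass Q" "bclass (P * Q) = bclass P * bclass Q"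
  by (simp_all add: zero_bpoly_def one_bpoly_def plus_bpoly.abs_eq minus_bpoly.abs_eq times_bpoly.abs_eq)

lemma beval_bclass: "beval v (bclass P) = peval v P"
  by (rule beval.abs_eq)

lemma bclass_eq_iff: "bclass P = bclass Q \<longleftrightarrow> P - Q \<in> bool_ideal"
  by (rule bpoly.abs_eq_iff)

lemma beval_simps [simp]:
  "beval v 0 = 0" "beval v 1 = 1" "beval v (p + q) = beval v p + beval v q"
  "beval v (p * q) = beval v p * beval v q"
  by (transfer; simp add: peval_add peval_mult)+

definition indet :: "nat \<Rightarrow> bpoly" where
  "indet i = bclass (Xvar i)"

lemma beval_indet [simp]: "beval v (indet i) = v i"
  by (simp add: indet_def beval_bclass)

lemma beval_sum: "beval v (sum f A) = (\<Sum>i\<in>A. beval v (f i))"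
  by (induction A rule: infinite_finite_induct) auto

lemma beval_prod: "beval v (prod f A) = (\<Prod>i\<in>A. beval v (f i))"
  by (induction A rule: infinite_finite_induct) auto

text \<open>
  \<open>bring N\<close> is the ring of Boolean polynomials in the first \<open>N\<close> indeterminates; lemma
  \<open>bring_quotient\<close> below shows that it is the quotient of the polynomial ring in these
  indeterminates alone.  In the ring with indeterminates \<open>x\<^sub>1, \<dots>, x\<^sub>n, y\<^sub>1, \<dots>, y\<^sub>m\<close>, which is
  \<open>bring (n + m)\<close>, \<open>x\<^sub>i\<close> is \<open>indet (i - 1)\<close> and \<open>y\<^sub>j\<close> is \<open>indet (n + j - 1)\<close>.
\<close>

definition bring :: "nat \<Rightarrow> bpoly set" where
  "bring N = bclass ` mpolys N"

text \<open>
  A square-free term is given by the finite set of the indices of the indeterminates dividing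
  it; its degree is the cardinality of this set.
\<close>

definition bterm :: "nat set \<Rightarrow> bpoly" where
  "bterm A = (\<Prod>i\<in>A. indet i)"

definition supp :: "bpoly \<Rightarrow> nat set set" where
  "supp f = (THE T. finite T \<and> (\<forall>A\<in>T. finite A) \<and> f = (\<Sum>A\<in>T. bterm A))"

definition linears :: "nat \<Rightarrow> bpoly set" where
  "linears N = {p. \<exists>(c::bit) (a :: nat \<Rightarrow> bit). p = of_bit c + (\<Sum>i<N. of_bit (a i) * indet i)}"

subsection \<open>Unique representation and the quotient in finitely many indeterminates\<close>

lemma subring_mpolys: "subring_in (mpolys N)"
proof -
  have "a * b \<in> mpolys N" if "a \<in> mpolys N" "b \<in> mpolys N" for a b
  proof -
    {
      fix m assume "m \<in> Poly_Mapping.keys (a * b)"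
      then obtain k l where kl: "m = k + l" "k \<in> Poly_Mapping.keys a" "l \<in> Poly_Mapping.keys b"
        using keys_mult[of a b] by blast
      then have "Poly_Mapping.keys m \<subseteq> {..<N}"
        using that keys_add[of k l] unfolding mpolys_def by blast
    }
    then show ?thesis by (auto simp: mpolys_def)
  qed
  moreover have "a - b \<in> mpolys N" if "a \<in> mpolys N" "b \<in> mpolys N" for a b
    using that keys_diff[of a b] unfolding mpolys_def by blast
  moreover have "1 \<in> mpolys N"
    by (simp add: mpolys_def)
  ultimately show ?thesis
    by (simp add: subring_in_def)
qed

lemma Xvar_mpolys: "i < N \<Longrightarrow> Xvar i \<in> mpolys N"
  by (simp add: Xvar_def mpolys_def)

definition bool_ideal_fin :: "nat \<Rightarrow> mpoly2 set" where
  "bool_ideal_fin N = ideal_gen (mpolys N) {Xvar i ^ 2 - Xvar i | i. i < N}"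

lemma bool_ideal_fin: "subring_ideal (mpolys N) (bool_ideal_fin N)"
  unfolding bool_ideal_fin_def
  by unfold_locales (auto intro!: subring_mpolys ideal_in_ideal_gen
      subring_inD[OF subring_mpolys] Xvar_mpolys)

lemma bool_ideal_fin_subset: "bool_ideal_fin N \<subseteq> bool_ideal"
proof -
  have "ideal_in (mpolys N) (bool_ideal \<inter> mpolys N)"
    by (auto simp: ideal_in_def intro: bool_ideal.zero bool_ideal.add bool_ideal.mult
        subring_inD[OF subring_mpolys])
  moreover have "{Xvar i ^ 2 - Xvar i | i. i < N} \<subseteq> bool_ideal \<inter> mpolys N"
    using ideal_gen_superset[of "{Xvar i ^ 2 - Xvar i | i. True}" UNIV]
    by (fold bool_ideal_def) (auto intro!: subring_inD[OF subring_mpolys] Xvar_mpolys)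
  ultimately show ?thesis
    unfolding bool_ideal_fin_def by (meson ideal_gen_minimal le_inf_iff)
qed

lemma single_sum:
  "Poly_Mapping.single (sum f A) (1::bit) = (\<Prod>i\<in>A. Poly_Mapping.single (f i) 1)"
  for f :: "nat \<Rightarrow> (nat \<Rightarrow>\<^sub>0 nat)"
proof (induction A rule: infinite_finite_induct)
  case (insert x F)
  then show ?case
    using mult_single[of "f x" "1::bit" "sum f F" 1] by simp
qed auto

lemma Xvar_power: "Xvar i ^ k = Poly_Mapping.single (Poly_Mapping.single i k) 1"
  by (induction k) (auto simp: Xvar_def mult_single single_add[symmetric])

lemma monomial_eq_prod:
  "Poly_Mapping.single m 1 = (\<Prod>i\<in>Poly_Mapping.keys m. Xvar i ^ Poly_Mapping.lookup m i)"
proof -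
  have "m = (\<Sum>i\<in>Poly_Mapping.keys m. Poly_Mapping.single i (Poly_Mapping.lookup m i))"
    by (rule poly_mapping_eqI) (auto simp: lookup_sum lookup_single when_def in_keys_iff)
  then have "Poly_Mapping.single m 1 = Poly_Mapping.single
      (\<Sum>i\<in>Poly_Mapping.keys m. Poly_Mapping.single i (Poly_Mapping.lookup m i)) (1::bit)"
    by simp
  then show ?thesis by (simp only: single_sum Xvar_power)
qed

lemma mpoly2_double: "P + P = 0" for P :: mpoly2
proof (rule poly_mapping_eqI)
  fix k
  have "b + b = 0" for b :: bit by (cases b) simp_all
  then show "Poly_Mapping.lookup (P + P) k = Poly_Mapping.lookup 0 k"
    by (simp only: lookup_add lookup_zero)
qed

lemma sum_sym_diff:
  assumes "finite T" "finite U" and "\<And>x :: 'b::ab_group_add. x + x = 0"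
  shows "sum f T + sum f U = (sum f ((T - U) \<union> (U - T)) :: 'b)"
proof -
  have "sum f T = sum f (T - U) + sum f (T \<inter> U)"
    by (subst sum.union_disjoint[symmetric]) (use assms(1) in \<open>auto intro: sum.cong\<close>)
  moreover have "sum f U = sum f (U - T) + sum f (T \<inter> U)"
    by (subst sum.union_disjoint[symmetric]) (use assms(2) in \<open>auto intro: sum.cong\<close>)
  moreover have "sum f ((T - U) \<union> (U - T)) = sum f (T - U) + sum f (U - T)"
    by (rule sum.union_disjoint) (use assms in auto)
  ultimately show ?thesis
    using assms(3)[of "sum f (T \<inter> U)"] by (simp add: algebra_simps)
qed

lemma normal_form:
  assumes "P \<in> mpolys N"
  shows "\<exists>T \<subseteq> Pow {..<N}. P - (\<Sum>A\<in>T. \<Prod>i\<in>A. Xvar i) \<in> bool_ideal_fin N"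
proof -
  interpret subring_ideal "mpolys N" "bool_ideal_fin N" by (rule bool_ideal_fin)
  have pow: "Xvar i ^ Suc k - Xvar i \<in> bool_ideal_fin N" if "i < N" for i k
  proof (induction k)
    case 0 show ?case by (simp add: zero)
  next
    case (Suc k)
    have "Xvar i * (Xvar i ^ Suc k - Xvar i) \<in> bool_ideal_fin N"
      using that Suc by (intro mult Xvar_mpolys)
    moreover have "Xvar i ^ 2 - Xvar i \<in> bool_ideal_fin N"
      unfolding bool_ideal_fin_def by (rule subsetD[OF ideal_gen_superset]) (use that in auto)
    ultimately have "Xvar i * (Xvar i ^ Suc k - Xvar i) + (Xvar i ^ 2 - Xvar i) \<in> bool_ideal_fin N"
      by (rule add)
    moreover have "Xvar i * (Xvar i ^ Suc k - Xvar i) + (Xvar i ^ 2 - Xvar i) =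
        Xvar i ^ Suc (Suc k) - Xvar i"
      by (simp only: right_diff_distrib power_Suc power2_eq_square diff_add_eq_diff_diff_swap) simp
    ultimately show ?case by (simp only:)
  qed
  have mon: "Poly_Mapping.single m 1 - (\<Prod>i\<in>Poly_Mapping.keys m. Xvar i) \<in> bool_ideal_fin N"
    if "Poly_Mapping.keys m \<subseteq> {..<N}" for m
    unfolding monomial_eq_prod
  proof (rule cong_prod)
    fix i assume i: "i \<in> Poly_Mapping.keys m"
    then obtain k where "Poly_Mapping.lookup m i = Suc k"
      by (auto simp: in_keys_iff gr0_conv_Suc)
    then show "Xvar i ^ Poly_Mapping.lookup m i - Xvar i \<in> bool_ideal_fin N"
      using pow[of i k] that i by auto
    show "Xvar i ^ Poly_Mapping.lookup m i \<in> mpolys N" "Xvar i \<in> mpolys N"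
      using that i by (auto intro!: subring_inD[OF subring_mpolys] Xvar_mpolys)
  qed
  have "\<exists>T \<subseteq> Pow {..<N}. (\<Sum>m\<in>K. Poly_Mapping.single m 1) - (\<Sum>A\<in>T. \<Prod>i\<in>A. Xvar i) \<in> bool_ideal_fin N"
    if "finite K" "\<forall>m\<in>K. Poly_Mapping.keys m \<subseteq> {..<N}" for K
    using that
  proof (induction K)
    case empty
    show ?case by (rule exI[of _ "{}"]) (simp add: zero)
  next
    case (insert m K)
    then obtain T where T: "T \<subseteq> Pow {..<N}"
      "(\<Sum>m\<in>K. Poly_Mapping.single m 1) - (\<Sum>A\<in>T. \<Prod>i\<in>A. Xvar i) \<in> bool_ideal_fin N" by auto
    let ?B = "Poly_Mapping.keys m"
    let ?U = "({?B} - T) \<union> (T - {?B})"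
    have fin: "finite T" using T(1) by (rule finite_subset) simp
    have "(\<Sum>m\<in>insert m K. Poly_Mapping.single m 1) - (\<Sum>A\<in>?U. \<Prod>i\<in>A. Xvar i) \<in> bool_ideal_fin N"
      using cong_add[OF mon[of m] T(2)] insert fin
        sum_sym_diff[of "{?B}" T "\<lambda>A. \<Prod>i\<in>A. Xvar i", OF _ fin mpoly2_double]
      by simp
    moreover have "?U \<subseteq> Pow {..<N}" using T(1) insert.prems by auto
    ultimately show ?case by blast
  qed
  from this[of "Poly_Mapping.keys P"] assms
  have "\<exists>T \<subseteq> Pow {..<N}. (\<Sum>m\<in>Poly_Mapping.keys P. Poly_Mapping.single m 1) -
      (\<Sum>A\<in>T. \<Prod>i\<in>A. Xvar i) \<in> bool_ideal_fin N"
    by (simp add: mpolys_def)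
  moreover have "(\<Sum>m\<in>Poly_Mapping.keys P. Poly_Mapping.single m 1) = P"
    by (subst (2) mpoly_expand) (auto intro!: sum.cong simp: in_keys_iff)
  ultimately show ?thesis by simp
qed

lemma bclass_prod: "bclass (prod f A) = (\<Prod>i\<in>A. bclass (f i))"
  by (induction A rule: infinite_finite_induct) (auto simp: bclass_hom)

lemma bclass_sum: "bclass (sum f A) = (\<Sum>i\<in>A. bclass (f i))"
  by (induction A rule: infinite_finite_induct) (auto simp: bclass_hom)

lemma bclass_normal_form: "bclass (\<Sum>A\<in>T. \<Prod>i\<in>A. Xvar i) = (\<Sum>A\<in>T. bterm A)"
  by (simp add: bclass_sum bclass_prod bterm_def indet_def)

lemma bpoly_double: "p + p = 0" for p :: bpoly
  by transfer (simp add: mpoly2_double bool_ideal.zero)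

lemma bterm_sum_unique:
  assumes "finite T" "\<forall>A\<in>T. finite A" "finite U" "\<forall>A\<in>U. finite A"
    and eq: "(\<Sum>A\<in>T. bterm A) = (\<Sum>A\<in>U. bterm A)"
  shows "T = U"
proof (rule ccontr)
  assume "T \<noteq> U"
  let ?D = "(T - U) \<union> (U - T)"
  have zero: "(\<Sum>A\<in>?D. bterm A) = 0"
    using sum_sym_diff[of T U bterm, OF assms(1,3) bpoly_double] eq bpoly_double by simp
  have "finite ?D" "?D \<noteq> {}" using assms \<open>T \<noteq> U\<close> by auto
  then obtain A where A: "A \<in> ?D" and min: "\<And>B. B \<in> ?D \<Longrightarrow> B \<subseteq> A \<Longrightarrow> B = A"
    using finite_has_minimal[of ?D] by metis
  let ?v = "\<lambda>i. of_bool (i \<in> A) :: bit"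
  have ev: "beval ?v (bterm B) = of_bool (B \<subseteq> A)" if "finite B" for B
    using that by (induction B) (auto simp: bterm_def)
  have "0 = beval ?v (\<Sum>B\<in>?D. bterm B)" unfolding zero by simp
  also have "\<dots> = (\<Sum>B\<in>?D. if B = A then 1 else 0)"
    unfolding beval_sum
  proof (rule sum.cong)
    fix B assume B: "B \<in> ?D"
    then have "finite B" using assms by auto
    then show "beval ?v (bterm B) = (if B = A then 1 else 0)"
      using ev[of B] min[OF B] by auto
  qed simp
  also have "\<dots> = 1" using A \<open>finite ?D\<close> by simp
  finally show False by simp
qed

theorem bring_quotient:
  assumes "P \<in> mpolys N" "Q \<in> mpolys N"
  shows "bclass P = bclass Q \<longleftrightarrow> P - Q \<in> ideal_gen (mpolys N) {Xvar i ^ 2 - Xvar i | i. i < N}"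
proof
  assume eq: "bclass P = bclass Q"
  interpret subring_ideal "mpolys N" "bool_ideal_fin N" by (rule bool_ideal_fin)
  obtain T U where T: "T \<subseteq> Pow {..<N}" "P - (\<Sum>A\<in>T. \<Prod>i\<in>A. Xvar i) \<in> bool_ideal_fin N"
    and U: "U \<subseteq> Pow {..<N}" "Q - (\<Sum>A\<in>U. \<Prod>i\<in>A. Xvar i) \<in> bool_ideal_fin N"
    using normal_form[OF assms(1)] normal_form[OF assms(2)] by metis
  have "bclass P = (\<Sum>A\<in>T. bterm A)" "bclass Q = (\<Sum>A\<in>U. bterm A)"
    using T(2) U(2) bool_ideal_fin_subset
    by (auto simp flip: bclass_normal_form simp: bclass_eq_iff)
  moreover have "finite T" "\<forall>A\<in>T. finite A" "finite U" "\<forall>A\<in>U. finite A"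
    using T(1) U(1) by (auto intro: finite_subset[of _ "{..<N}"] finite_subset[of _ "Pow {..<N}"])
  ultimately have "T = U"
    using eq bterm_sum_unique by metis
  with T(2) U(2) show "P - Q \<in> ideal_gen (mpolys N) {Xvar i ^ 2 - Xvar i | i. i < N}"
    unfolding bool_ideal_fin_def[symmetric] using cong_trans swap by blast
next
  assume "P - Q \<in> ideal_gen (mpolys N) {Xvar i ^ 2 - Xvar i | i. i < N}"
  then show "bclass P = bclass Q"
    using bool_ideal_fin_subset by (auto simp: bclass_eq_iff bool_ideal_fin_def)
qed

lemma bring_supp:
  assumes "f \<in> bring N"
  shows "supp f \<subseteq> Pow {..<N}" "f = (\<Sum>A\<in>supp f. bterm A)"
proof -
  obtain P where P: "P \<in> mpolys N" "f = bclass P"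
    using assms by (auto simp: bring_def)
  obtain T where T: "T \<subseteq> Pow {..<N}" "P - (\<Sum>A\<in>T. \<Prod>i\<in>A. Xvar i) \<in> bool_ideal_fin N"
    using normal_form[OF P(1)] by blast
  have f: "f = (\<Sum>A\<in>T. bterm A)"
    using T(2) P(2) bool_ideal_fin_subset
    by (auto simp flip: bclass_normal_form simp: bclass_eq_iff)
  have fin: "finite T" "\<forall>A\<in>T. finite A"
    using T(1) by (auto intro: finite_subset[of _ "{..<N}"] finite_subset[of _ "Pow {..<N}"])
  have "supp f = T"
    unfolding supp_def
    using f fin bterm_sum_unique by (intro the_equality) metis+
  with T(1) f show "supp f \<subseteq> Pow {..<N}" "f = (\<Sum>A\<in>supp f. bterm A)" by auto
qed

lemma subring_bring: "subring_in (bring N)"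
proof -
  have "1 \<in> bring N"
    unfolding bring_def using subring_inD(1)[OF subring_mpolys] by (metis bclass_hom(2) image_eqI)
  then show ?thesis
    using subring_inD(4,6)[OF subring_mpolys]
    unfolding subring_in_def bring_def by (auto simp flip: bclass_hom)
qed

section \<open>Zero sets and 2-XNF representations\<close>

text \<open>Points of the affine space of dimension \<open>N\<close> are the lists of length \<open>N\<close>.\<close>

definition zeros :: "nat \<Rightarrow> bpoly set \<Rightarrow> bit list set" where
  "zeros N S = {v. length v = N \<and> (\<forall>p\<in>S. beval ((!) v) p = 0)}"

definition proj_equiv :: "nat \<Rightarrow> bit list set \<Rightarrow> bit list set \<Rightarrow> bool" where
  "proj_equiv n S T \<longleftrightarrow> bij_betw (take n) T S"

text \<open>
  The number \<open>m\<close> of additional indeterminates is a parameter, since the zero set of \<open>S\<close>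
  depends on the ring in which \<open>S\<close> is considered.
\<close>

definition two_xnf_rep :: "nat \<Rightarrow> nat \<Rightarrow> bpoly set \<Rightarrow> bpoly set \<Rightarrow> bool" where
  "two_xnf_rep n m I S \<longleftrightarrow>
     (\<exists>Q L. finite Q \<and> Q \<subseteq> linears (n + m) \<times> linears (n + m) \<and>
            finite L \<and> L \<subseteq> linears (n + m) \<and>
            S = (\<lambda>(f, g). f * g) ` Q \<union> L) \<and>
     proj_equiv n (zeros n I) (zeros (n + m) S)"

section \<open>The procedure ANFto2XNF\<close>

text \<open>
  The states of a run.  \<open>i\<close> is the number of indeterminates introduced so far, \<open>M\<close> and \<open>f\<close>
  are the current values of these program variables, and \<open>W\<close> is the set of those terms in the
  support of the input that the outer loop has not visited yet.
  \<open>AtFor i M f W\<close> is at the head of the outer loop and \<open>AtWhile i M f W t\<close> at the head of the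
  inner loop with current term \<open>t\<close>.  In \<open>Returned i S\<close> the output is \<open>S\<close>, a subset of
  \<open>bring (n + i)\<close>.
\<close>

datatype anf_state =
    AtFor nat "bpoly set" bpoly "nat set set"
  | AtWhile nat "bpoly set" bpoly "nat set set" "nat set"
  | Returned nat "bpoly set"

text \<open>
  The relation is nondeterministic in the order of the terms and in the choice of the two
  indeterminates.  The new indeterminate \<open>y\<^sub>i\<^sub>+\<^sub>1\<close> is \<open>indet (n + i)\<close>.
\<close>

inductive anf_step :: "nat \<Rightarrow> anf_state \<Rightarrow> anf_state \<Rightarrow> bool" for n :: nat where
  pick: "t \<in> W \<Longrightarrow> anf_step n (AtFor i M f W) (AtWhile i M f (W - {t}) t)"
| body: "\<lbrakk>card t > 1; a \<in> t; b \<in> t; a \<noteq> b; s = t - {a, b};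
          y = indet (n + i); f' = f - bterm t\<rbrakk> \<Longrightarrow>
    anf_step n (AtWhile i M f W t)
      (AtWhile (Suc i) (M \<union> {y * (indet b + 1), indet b * (indet a + y)})
        (y * bterm s + f') W (insert (n + i) s))"
| exit_while: "\<not> card t > 1 \<Longrightarrow> anf_step n (AtWhile i M f W t) (AtFor i M f W)"
| return: "anf_step n (AtFor i M f {}) (Returned i (M \<union> {f}))"

definition anf_start :: "bpoly \<Rightarrow> anf_state" where
  "anf_start f = AtFor 0 {} f (supp f)"

end

theory Submission
  imports Defs
begin

text \<open>
  The two quadrics adjoined for a new indeterminate \<open>y\<close> vanish at a point exactly if
  \<open>y = \<ell>\<^sub>1 \<ell>\<^sub>2\<close> holds there.  Hence every point of \<open>\<F>\<^sub>2\<^sup>n\<close> extends in exactly one way to a common zero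
  of \<open>M\<close>, and on these zeros the current polynomial agrees with the input.  The loops end
  because each rewriting lowers the degree of the current term.
\<close>

section \<open>Linear Boolean polynomials\<close>

text \<open>This rests on characteristic two: for \<open>c = d = 1\<close> the left side is
  \<open>0\<close> and the right side is \<open>1 + 1\<close>.\<close>

lemma of_bit_add_bpoly: "of_bit (c + d) = (of_bit c + of_bit d :: bpoly)"
  by (cases c; cases d) (simp_all add: bpoly_double)

lemma linears_add:
  assumes "p \<in> linears N" "q \<in> linears N"
  shows "p + q \<in> linears N"
proof -
  from assms obtain c a d b where
    "p = of_bit c + (\<Sum>i<N. of_bit (a i) * indet i)"
    "q = of_bit d + (\<Sum>i<N. of_bit (b i) * indet i)"
    by (auto simp: linears_def)
  then have "p + q = of_bit (c + d) + (\<Sum>i<N. of_bit (a i + b i) * indet i)"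
    unfolding of_bit_add_bpoly distrib_right sum.distrib by (simp only: ac_simps)
  then show ?thesis
    unfolding linears_def mem_Collect_eq by (intro exI[of _ "c + d"] exI[of _ "\<lambda>i. a i + b i"])
qed

lemma linears_0: "0 \<in> linears N"
  unfolding linears_def mem_Collect_eq by (intro exI[of _ 0] exI[of _ "\<lambda>_. 0"]) simp

lemma linears_1: "1 \<in> linears N"
  unfolding linears_def mem_Collect_eq by (rule exI[of _ 1], rule exI[of _ "\<lambda>_. 0"]) simp

lemma linears_indet:
  assumes "j < N"
  shows "indet j \<in> linears N"
proof -
  have "(\<Sum>i<N. of_bit (if i = j then 1 else 0 :: bit) * indet i) =
      (\<Sum>i<N. if i = j then indet i else 0)"
    by (rule sum.cong) auto
  with assms have "indet j = of_bit 0 + (\<Sum>i<N. of_bit (if i = j then 1 else 0 :: bit) * indet i)"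
    by simp
  then show ?thesis
    unfolding linears_def mem_Collect_eq
    by (intro exI[of _ 0] exI[of _ "\<lambda>i. if i = j then 1 else 0"])
qed

lemma linears_mono:
  assumes "M \<le> N"
  shows "linears M \<subseteq> linears N"
proof
  fix p assume "p \<in> linears M"
  then obtain c a where p: "p = of_bit c + (\<Sum>i<M. of_bit (a i) * indet i)"
    by (auto simp: linears_def)
  \<comment> \<open>The coefficients are padded with \<open>0\<close> from index \<open>M\<close>
    on.\<close>
  have "(\<Sum>i<M. of_bit (a i) * indet i) =
      (\<Sum>i<N. of_bit (if i < M then a i else 0) * indet i)"
    using assms by (intro sum.mono_neutral_cong_left) auto
  with p show "p \<in> linears N"
    unfolding linears_def mem_Collect_eq
    by (intro exI[of _ c] exI[of _ "\<lambda>i. if i < M then a i else 0"]) simp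
qed

text \<open>The inner loop stops at such terms: the empty product \<open>1\<close> or a single
  indeterminate.\<close>

lemma linears_bterm:
  assumes "\<not> card t > 1" "t \<subseteq> {..<N}"
  shows "bterm t \<in> linears N"
proof -
  \<comment> \<open>An infinite set has \<open>card\<close> equal to \<open>0\<close>, so finiteness
    has to be known before the case split.\<close>
  have "finite t" using assms(2) by (rule finite_subset) simp
  with assms(1) consider "t = {}" | j where "t = {j}"
    by (cases "card t") (auto simp: card_1_singleton_iff)
  then show ?thesis
    using assms(2) by cases (auto simp: bterm_def linears_1 linears_indet)
qed

lemma indet_bring: "i < N \<Longrightarrow> indet i \<in> bring N"
  by (auto simp: indet_def bring_def intro: Xvar_mpolys)

lemma linears_subset_bring: "linears N \<subseteq> bring N"
proof -
  have "of_bit c \<in> bring N" for c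
    by (cases c) (auto intro: subring_inD[OF subring_bring])
  then have "of_bit c + (\<Sum>i<N. of_bit (a i) * indet i) \<in> bring N" for c and a :: "nat \<Rightarrow> bit"
    by (intro subring_inD(5,6)[OF subring_bring] subring_in_sum[OF subring_bring] indet_bring) auto
  then show ?thesis
    unfolding linears_def by blast
qed

section \<open>Evaluation and zero sets\<close>

lemma beval_bterm: "beval v (bterm A) = (\<Prod>i\<in>A. v i)"
  by (simp add: bterm_def beval_prod)

lemma beval_minus: "beval v (p - q) = beval v p - beval v q"
  by transfer (rule peval_minus)

text \<open>The terms in the support of \<open>p\<close> contain only indices below
  \<open>N\<close>, so only these coordinates enter its value.\<close>

lemma beval_cong:
  assumes "p \<in> bring N" "\<And>i. i < N \<Longrightarrow> v i = w i"
  shows "beval v p = beval w p"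
proof -
  have "(\<Prod>i\<in>A. v i) = (\<Prod>i\<in>A. w i)" if "A \<in> supp p" for A
    using bring_supp(1)[OF assms(1)] that by (intro prod.cong assms(2)) auto
  then show ?thesis
    by (subst (1 2) bring_supp(2)[OF assms(1)]) (simp add: beval_sum beval_bterm)
qed

lemma beval_take:
  assumes "p \<in> bring k" "k \<le> length v"
  shows "beval ((!) (take k v)) p = beval ((!) v) p"
  by (rule beval_cong[OF assms(1)]) simp

text \<open>The elements of \<open>R\<close> that vanish at a fixed point form an ideal of
  \<open>R\<close>; if it contains \<open>S\<close>, it contains the generated ideal.\<close>

lemma zeros_ideal_gen:
  assumes "subring_in R" "S \<subseteq> R"
  shows "zeros N (ideal_gen R S) = zeros N S"
proof -
  have "beval v p = 0" if "\<forall>q\<in>S. beval v q = 0" "p \<in> ideal_gen R S" for v p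
  proof -
    have "ideal_in R {q \<in> R. beval v q = 0}"
      using subring_inD[OF assms(1)] by (auto simp: ideal_in_def)
    from ideal_gen_minimal[OF this, of S] that assms(2) show ?thesis by auto
  qed
  then show ?thesis
    using ideal_gen_superset[of S R] unfolding zeros_def by blast
qed

section \<open>Adjoining one indeterminate\<close>

text \<open>If \<open>q\<close> is \<open>0\<close> at \<open>v\<close>, the first quadric forces
  \<open>y\<close> to be \<open>0\<close>; if \<open>q\<close> is \<open>1\<close>, the second
  forces \<open>y\<close> to equal \<open>p\<close>.\<close>

lemma gate_zero_iff:
  "beval v (y * (q + 1)) = 0 \<and> beval v (q * (p + y)) = 0 \<longleftrightarrow> beval v y = beval v p * beval v q"
  by (cases "beval v y"; cases "beval v p"; cases "beval v q") simp_all

text \<open>This is the product part of \<open>two_xnf_rep\<close>; the linear part stays free for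
  the final value of \<open>f\<close>.\<close>

definition quadrics :: "nat \<Rightarrow> bpoly set \<Rightarrow> bool" where
  "quadrics N M \<longleftrightarrow>
     (\<exists>Q. finite Q \<and> Q \<subseteq> linears N \<times> linears N \<and> M = (\<lambda>(f, g). f * g) ` Q)"

lemma quadrics_empty: "quadrics N {}"
  unfolding quadrics_def by (rule exI[of _ "{}"]) simp

lemma quadrics_insert:
  assumes "quadrics N M" "p \<in> linears N" "q \<in> linears N"
  shows "quadrics N (insert (p * q) M)"
proof -
  from assms(1) obtain Q where "finite Q" "Q \<subseteq> linears N \<times> linears N" "M = (\<lambda>(f, g). f * g) ` Q"
    by (auto simp: quadrics_def)
  with assms(2,3) show ?thesis
    unfolding quadrics_def by (intro exI[of _ "insert (p, q) Q"]) auto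
qed

lemma quadrics_mono: "quadrics N M \<Longrightarrow> N \<le> N' \<Longrightarrow> quadrics N' M"
  unfolding quadrics_def using linears_mono[of N N'] by (elim exE) (rule exI, blast)

lemma quadrics_subset_bring: "quadrics N M \<Longrightarrow> M \<subseteq> bring N"
  using linears_subset_bring[of N] unfolding quadrics_def
  by (auto intro!: subring_inD(6)[OF subring_bring])

text \<open>The polynomials in \<open>M\<close>, \<open>p\<close> and \<open>q\<close> do not
  involve coordinate \<open>N\<close>, and the two quadrics fix that coordinate as the value of
  \<open>p * q\<close> at the first \<open>N\<close> coordinates.\<close>

lemma bij_zeros_gate:
  assumes "M \<subseteq> bring N" "p \<in> bring N" "q \<in> bring N"
  shows "bij_betw (take N)
    (zeros (Suc N) (M \<union> {indet N * (q + 1), q * (p + indet N)})) (zeros N M)"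
    (is "bij_betw _ ?Z' _")
proof -
  have Z': "v \<in> ?Z' \<longleftrightarrow> length v = Suc N \<and> take N v \<in> zeros N M \<and>
      v ! N = beval ((!) (take N v)) p * beval ((!) (take N v)) q" for v
  proof -
    have "beval ((!) (take N v)) r = beval ((!) v) r" if "r \<in> bring N" "length v = Suc N" for r
      using that by (simp add: beval_take)
    moreover from this have "(\<forall>r\<in>M. beval ((!) (take N v)) r = 0) \<longleftrightarrow> (\<forall>r\<in>M. beval ((!) v) r = 0)"
      if "length v = Suc N"
      using assms(1) that by (intro ball_cong) auto
    ultimately show ?thesis
      using assms(2,3) gate_zero_iff[of "(!) v" "indet N" q p]
      by (auto simp: zeros_def simp del: beval_simps(3,4))
  qed
  show ?thesis
  \<comment> \<open>The inverse of the projection appends the forced value of the new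
    coordinate.\<close>
  proof (rule bij_betw_byWitness[where
        f' = "\<lambda>v. v @ [beval ((!) v) p * beval ((!) v) q]"])
    show "\<forall>v\<in>?Z'. take N v @ [beval ((!) (take N v)) p * beval ((!) (take N v)) q] = v"
    proof
      fix v assume "v \<in> ?Z'"
      with Z' have "length v = Suc N"
        "v ! N = beval ((!) (take N v)) p * beval ((!) (take N v)) q" by blast+
      then show "take N v @ [beval ((!) (take N v)) p * beval ((!) (take N v)) q] = v"
        by (metis lessI take_Suc_conv_app_nth take_all order_refl)
    qed
    show "\<forall>w\<in>zeros N M. take N (w @ [beval ((!) w) p * beval ((!) w) q]) = w"
      by (simp add: zeros_def)
    show "take N ` ?Z' \<subseteq> zeros N M" using Z' by blast
    show "(\<lambda>v. v @ [beval ((!) v) p * beval ((!) v) q]) ` zeros N M \<subseteq> ?Z'"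
    proof clarify
      fix w assume w: "w \<in> zeros N M"
      then have "length w = N" by (simp add: zeros_def)
      with w show "w @ [beval ((!) w) p * beval ((!) w) q] \<in> ?Z'"
        unfolding Z' by (auto simp: nth_append)
    qed
  qed
qed

text \<open>Since \<open>zeros n {}\<close> is the whole space, the second conjunct says that each
  of its points extends uniquely to a zero of \<open>M\<close>.\<close>

definition extension_system :: "nat \<Rightarrow> nat \<Rightarrow> bpoly set \<Rightarrow> bool" where
  "extension_system n i M \<longleftrightarrow> quadrics (n + i) M \<and> proj_equiv n (zeros n {}) (zeros (n + i) M)"

lemma extension_system_gate:
  assumes "extension_system n i M" "a < n + i" "b < n + i"
  shows "extension_system n (Suc i)
    (M \<union> {indet (n + i) * (indet b + 1), indet b * (indet a + indet (n + i))})"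
    (is "extension_system n _ ?M'")
proof -
  have M: "quadrics (n + i) M" "bij_betw (take n) (zeros (n + i) M) (zeros n {})"
    using assms(1) by (auto simp: extension_system_def proj_equiv_def)
  have "quadrics (n + Suc i) ?M'"
    using assms(2,3) quadrics_mono[OF M(1), of "n + Suc i"]
    by (auto intro!: quadrics_insert linears_add linears_indet linears_1)
  moreover have "bij_betw (take (n + i)) (zeros (n + Suc i) ?M') (zeros (n + i) M)"
    using bij_zeros_gate[of M "n + i" "indet a" "indet b"] assms(2,3) quadrics_subset_bring[OF M(1)]
    by (simp add: indet_bring)
  \<comment> \<open>Dropping the newest coordinate and then the remaining new ones is the same as
    \<open>take n\<close>.\<close>
  from bij_betw_trans[OF this M(2)] have "bij_betw (take n) (zeros (n + Suc i) ?M') (zeros n {})"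
    by (simp add: comp_def min_def)
  ultimately show ?thesis
    by (simp add: extension_system_def proj_equiv_def)
qed

text \<open>Assignments to all indeterminates are used instead of lists, so that no dimension has to
  change when an indeterminate is added.\<close>

definition equal_on_zeros :: "bpoly set \<Rightarrow> bpoly \<Rightarrow> bpoly \<Rightarrow> bool" where
  "equal_on_zeros M f g \<longleftrightarrow> (\<forall>v. (\<forall>p\<in>M. beval v p = 0) \<longrightarrow> beval v f = beval v g)"

lemma equal_on_zeros_refl: "equal_on_zeros M f f"
  by (simp add: equal_on_zeros_def)

text \<open>On the zeros of the enlarged system \<open>y\<close> equals the product of the two
  chosen indeterminates, so the rewritten term has the value of \<open>bterm t\<close>.\<close>

lemma equal_on_zeros_gate:
  assumes "equal_on_zeros M f g" "finite t" "a \<in> t" "b \<in> t" "a \<noteq> b"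
  shows "equal_on_zeros (M \<union> {y * (indet b + 1), indet b * (indet a + y)})
    (y * bterm (t - {a, b}) + (f - bterm t)) g"
  unfolding equal_on_zeros_def
proof (intro allI impI)
  fix v assume v: "\<forall>p\<in>M \<union> {y * (indet b + 1), indet b * (indet a + y)}. beval v p = 0"
  then have y: "beval v y = v a * v b"
    using gate_zero_iff[of v y "indet b" "indet a"] by (simp del: beval_simps)
  have "t = insert a (insert b (t - {a, b}))"
    using assms(3,4) by blast
  then have "bterm t = indet a * indet b * bterm (t - {a, b})"
    unfolding bterm_def using assms(2,5)
    by (metis (no_types, lifting) DiffD2 finite_Diff insertCI insertE mult.assoc prod.insert
        finite_insert)
  then have "beval v (y * bterm (t - {a, b}) + (f - bterm t)) = beval v f"
    by (simp only: beval_simps beval_minus beval_indet y add_diff_eq add_diff_cancel_left')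
  with v assms(1) show "beval v (y * bterm (t - {a, b}) + (f - bterm t)) = beval v g"
    by (auto simp: equal_on_zeros_def)
qed

text \<open>On the zeros of \<open>M\<close>, \<open>h\<close> has the value of \<open>f\<close>,
  which depends only on the first \<open>n\<close> coordinates. Adjoining \<open>h\<close> thus
  keeps exactly the points above zeros of \<open>f\<close>, and the bijection restricts.\<close>

lemma two_xnf_rep_extension_system:
  assumes M: "extension_system n i M" and h: "h \<in> linears (n + i)" "equal_on_zeros M h f"
    and f: "f \<in> bring n"
  shows "two_xnf_rep n i (ideal_gen (bring n) {f}) (M \<union> {h})"
proof -
  have bij: "bij_betw (take n) (zeros (n + i) M) (zeros n {})"
    using M by (simp add: extension_system_def proj_equiv_def)
  have iff: "v \<in> zeros (n + i) (M \<union> {h}) \<longleftrightarrow> take n v \<in> zeros n {f}"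
    if "v \<in> zeros (n + i) M" for v
    using that h(2) beval_take[OF f, of v] by (auto simp: zeros_def equal_on_zeros_def)
  have "take n ` zeros (n + i) (M \<union> {h}) = zeros n {f}"
  proof -
    have "zeros (n + i) (M \<union> {h}) = {v \<in> zeros (n + i) M. take n v \<in> zeros n {f}}"
      using iff by (auto simp: zeros_def)
    \<comment> \<open>Every zero of \<open>f\<close> is a point of \<open>zeros n {}\<close>, hence
      has a preimage.\<close>
    moreover have "zeros n {f} \<subseteq> take n ` zeros (n + i) M"
      using bij by (auto simp: bij_betw_def zeros_def)
    ultimately show ?thesis by auto
  qed
  moreover have "zeros (n + i) (M \<union> {h}) \<subseteq> zeros (n + i) M"
    by (auto simp: zeros_def)
  ultimately have "bij_betw (take n) (zeros (n + i) (M \<union> {h})) (zeros n {f})"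
    using bij_betw_subset[OF bij] by blast
  moreover have "zeros n (ideal_gen (bring n) {f}) = zeros n {f}"
    using f by (intro zeros_ideal_gen subring_bring) simp
  moreover obtain Q where "finite Q" "Q \<subseteq> linears (n + i) \<times> linears (n + i)"
    "M = (\<lambda>(f, g). f * g) ` Q"
    using M by (auto simp: extension_system_def quadrics_def)
  then have "\<exists>Q L. finite Q \<and> Q \<subseteq> linears (n + i) \<times> linears (n + i) \<and>
      finite L \<and> L \<subseteq> linears (n + i) \<and> M \<union> {h} = (\<lambda>(f, g). f * g) ` Q \<union> L"
    using h(1) by (intro exI[of _ Q] exI[of _ "{h}"]) simp
  ultimately show ?thesis
    by (simp add: two_xnf_rep_def proj_equiv_def)
qed

section \<open>The loop invariant\<close>

text \<open>Removing the pending terms from \<open>f\<close> must leave a linear polynomial, so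
  \<open>f\<close> is linear once none is left. Stating this by subtraction avoids tracking
  \<open>supp f\<close> and possible cancellations. Only the current term can contain new
  indeterminates.\<close>

fun anf_invariant :: "nat \<Rightarrow> bpoly \<Rightarrow> anf_state \<Rightarrow> bool" where
  "anf_invariant n g (AtFor i M f W) \<longleftrightarrow>
     extension_system n i M \<and> equal_on_zeros M f g \<and> W \<subseteq> Pow {..<n} \<and>
     f - sum bterm W \<in> linears (n + i)"
| "anf_invariant n g (AtWhile i M f W t) \<longleftrightarrow>
     extension_system n i M \<and> equal_on_zeros M f g \<and> W \<subseteq> Pow {..<n} \<and>
     t \<subseteq> {..<n + i} \<and> f - bterm t - sum bterm W \<in> linears (n + i)"
| "anf_invariant n g (Returned i S) \<longleftrightarrow> two_xnf_rep n i (ideal_gen (bring n) {g}) S"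

lemma anf_invariant_start:
  assumes "f \<in> bring n"
  shows "anf_invariant n f (anf_start f)"
proof -
  have "take n v = v" if "v \<in> zeros n {}" for v
    using that by (simp add: zeros_def)
  then have "bij_betw (take n) (zeros n {}) (zeros n {})"
    by (simp add: bij_betw_def inj_on_def)
  with bring_supp[OF assms] show ?thesis
    by (simp add: anf_start_def extension_system_def proj_equiv_def quadrics_empty
        equal_on_zeros_refl linears_0)
qed

lemma anf_invariant_step:
  assumes "g \<in> bring n" "anf_step n c c'" "anf_invariant n g c"
  shows "anf_invariant n g c'"
  using assms(2,3)
proof cases
  case (pick t W i M f)
  then have "finite W" "t \<subseteq> {..<n + i}"
    using assms(3) by (auto intro: finite_subset[of W "Pow {..<n}"] trans_less_add1)
  with pick assms(3) show ?thesis
    by (auto simp: sum.remove[of W t] algebra_simps)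
next
  case (body t a b s y i f' f M W)
  note inv = assms(3)[unfolded body(1) anf_invariant.simps]
  have fin: "finite t" using inv finite_subset by blast
  \<comment> \<open>The index \<open>n + i\<close> is not in \<open>s\<close>, because
    \<open>t\<close> has only smaller indices. Hence subtracting the new current term from the new
    polynomial gives \<open>f - bterm t\<close>, as before the step.\<close>
  have "y * bterm s = bterm (insert (n + i) s)"
    using inv fin body by (subst bterm_def, subst prod.insert) (auto simp: bterm_def)
  moreover have "f - bterm t - sum bterm W \<in> linears (n + Suc i)"
    using inv linears_mono[of "n + i" "n + Suc i"] by auto
  moreover have "extension_system n (Suc i) (M \<union> {y * (indet b + 1), indet b * (indet a + y)})"
    using inv body extension_system_gate[of n i M a b] by auto
  moreover have "equal_on_zeros (M \<union> {y * (indet b + 1), indet b * (indet a + y)})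
      (y * bterm s + f') g"
    using inv body fin equal_on_zeros_gate[of M f g t a b y] by auto
  ultimately show ?thesis
    using inv body by auto
next
  case (exit_while t i M f W)
  \<comment> \<open>The current term has become linear and joins the linear remainder.\<close>
  then have "(f - bterm t - sum bterm W) + bterm t \<in> linears (n + i)"
    using assms(3) by (intro linears_add linears_bterm) auto
  with exit_while assms(3) show ?thesis by (simp add: algebra_simps)
next
  case (return i M f)
  with assms(1,3) show ?thesis
    by (simp add: two_xnf_rep_extension_system del: Un_insert_right)
qed

lemma anf_invariant_steps:
  assumes "g \<in> bring n" "(anf_step n)\<^sup>*\<^sup>* c c'" "anf_invariant n g c"
  shows "anf_invariant n g c'"
  using assms(2,3) by induction (auto intro: anf_invariant_step[OF assms(1)])

section \<open>Termination\<close>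

text \<open>The offsets make control steps count: picking a term trades its
  \<open>card A + 2\<close> and the \<open>1\<close> for \<open>2 + card t\<close>, one less in
  total; leaving the inner loop lowers \<open>2\<close> to \<open>1\<close>.\<close>

fun anf_size :: "anf_state \<Rightarrow> nat" where
  "anf_size (AtFor i M f W) = 1 + (\<Sum>A\<in>W. card A + 2)"
| "anf_size (AtWhile i M f W t) = 2 + (\<Sum>A\<in>W. card A + 2) + card t"
| "anf_size (Returned i S) = 0"

text \<open>The invariant supplies finiteness of \<open>W\<close>, without which the sum would be
  \<open>0\<close> by default.\<close>

lemma anf_size_step:
  assumes "anf_step n c c'" "anf_invariant n g c"
  shows "anf_size c' < anf_size c"
  using assms
proof cases
  case (pick t W i M f)
  then have "finite W"
    using assms(2) by (auto intro: finite_subset[of W "Pow {..<n}"])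
  with pick show ?thesis
    by (simp add: sum.remove[of W t])
next
  case (body t a b s y i f' f M W)
  have "card (insert (n + i) s) \<le> Suc (card s)"
    by (rule card_insert_le_m1) auto
  \<comment> \<open>Two indeterminates leave the term and at most one enters; as
    \<open>card t > 1\<close>, the subtraction is not truncated.\<close>
  moreover have "card s = card t - 2"
    using body by (simp add: card_Diff_subset)
  ultimately show ?thesis
    using body by simp
qed auto

text \<open>Maximal runs can end only with an output: an inner loop that does not exit has a term
  with two distinct indeterminates to replace.\<close>

lemma anf_step_progress:
  assumes "\<nexists>c'. anf_step n c c'"
  obtains i S where "c = Returned i S"
proof (cases c)
  case (AtFor i M f W)
  then show thesis
    using assms anf_step.pick[of _ W n i M f] anf_step.return[of n i M f] by (metis ex_in_conv)
next
  case (AtWhile i M f W t)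
  then have "card t > 1"
    using assms anf_step.exit_while by blast
  then obtain a b where "a \<in> t" "b \<in> t" "a \<noteq> b"
    by (metis One_nat_def card_le_Suc0_iff_eq card.infinite not_less not_less_zero)
  with AtWhile assms \<open>card t > 1\<close> show thesis
    using anf_step.body by blast
qed (use that in blast)

theorem proposition3p15:
  fixes n :: nat and f :: bpoly
  assumes "f \<in> bring n"
  shows "(\<nexists>c :: nat \<Rightarrow> anf_state. c 0 = anf_start f \<and> (\<forall>k. anf_step n (c k) (c (Suc k)))) \<and>
    (\<forall>c. (anf_step n)\<^sup>*\<^sup>* (anf_start f) c \<and> (\<nexists>c'. anf_step n c c') \<longrightarrow>
       (\<exists>m S. c = Returned m S \<and> two_xnf_rep n m (ideal_gen (bring n) {f}) S))"
proof (intro conjI allI impI notI)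
  assume "\<exists>c. c 0 = anf_start f \<and> (\<forall>k. anf_step n (c k) (c (Suc k)))"
  then obtain c where c: "c 0 = anf_start f" "\<And>k. anf_step n (c k) (c (Suc k))" by blast
  have "anf_invariant n f (c k)" for k
    by (induction k)
      (use c anf_invariant_start[OF assms] anf_invariant_step[OF assms] in auto)
  then have "\<And>k. anf_size (c (Suc k)) < anf_size (c k)"
    using anf_size_step c(2) by blast
  \<comment> \<open>The sizes along an infinite run would form an infinite descending sequence of
    natural numbers.\<close>
  then show False
    using wf_no_infinite_down_chainE[OF wf_less, of "\<lambda>k. anf_size (c k)"] by auto
next
  fix c assume c: "(anf_step n)\<^sup>*\<^sup>* (anf_start f) c \<and> (\<nexists>c'. anf_step n c c')"
  then obtain m S where "c = Returned m S"
    using anf_step_progress by metis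
  with c anf_invariant_steps[OF assms _ anf_invariant_start[OF assms]]
  show "\<exists>m S. c = Returned m S \<and> two_xnf_rep n m (ideal_gen (bring n) {f}) S"
    by fastforce
qed

end
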